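(* Let $\mathcal{H}$ be a complex Hilbert space, let $T\in\mathcal{L}^h$ have closed range and let $T=T_1-T_2$ be the positive orthogonal decomposition of $T$. The following assertions are equivalent: (1) the MP-proper splitting of $T$ converges; (2) $\max\{\|P_{T_1}-T_1^2\|,\|P_{T_2}-T_2^2\|\}<1$; (3) $\|T_i\|<\sqrt{2}$ for $i=1,2$; (4) $\|T\|<\sqrt{2}$.
   Context: $\mathcal{L}(\mathcal{H})$ is the algebra of bounded linear operators on $\mathcal{H}$; $\mathcal{L}^h$ and $\mathcal{L}^+$ are the sets of selfadjoint and positive (semidefinite) operators in it; $\mathcal{R}(\cdot)$ denotes range; $\rho(\cdot)$ is the spectral radius; $P_A$ is the orthogonal projection onto $\overline{\mathcal{R}(A)}$; $A^\dagger$ is the Moore-Penrose inverse of a closed range operator $A$. A proper splitting of $T$ is a decomposition $T=U-V$ with $U,V\in\mathcal{L}(\mathcal{H})$ such that $U$ has the same range and nullspace as $T$; it converges if $\rho(U^\dagger V)<1$. The MP-proper (Moore-Penrose proper) splitting of a normal closed range operator $T$ is $T=T^\dagger-V$, i.e. $U=T^\dagger$ and $V=T^\dagger-T$. The positive orthogonal decomposition of $T\in\mathcal{L}^h$ is the unique decomposition $T=T_1-T_2$ with $T_1,T_2\in\mathcal{L}^+$ and $\overline{\mathcal{R}(T_1)}\oplus\overline{\mathcal{R}(T_2)}=\overline{\mathcal{R}(T)}$ (orthogonal sum); explicitly $T_1=\frac{|T|+T}{2}$, $T_2=\frac{|T|-T}{2}$. *)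

theory Defs
  imports "HOL-Analysis.Analysis"
begin

text \<open>Complex Hilbert spaces. The underlying real Hilbert space structure (in particular the norm) is
  the one induced by the complex structure. The inner product is linear in its first argument.\<close>

class complex_hilbert_space = real_inner + banach +
  fixes scaleC :: "complex \<Rightarrow> 'a \<Rightarrow> 'a"  (infixr \<open>*\<^sub>C\<close> 75)
    and cinner :: "'a \<Rightarrow> 'a \<Rightarrow> complex"
  assumes scaleC_add_right: "c *\<^sub>C (x + y) = c *\<^sub>C x + c *\<^sub>C y"
    and scaleC_add_left: "(c + d) *\<^sub>C x = c *\<^sub>C x + d *\<^sub>C x"
    and scaleC_scaleC: "c *\<^sub>C d *\<^sub>C x = (c * d) *\<^sub>C x"
    and scaleC_one: "1 *\<^sub>C x = x"
    and scaleR_eq_scaleC: "r *\<^sub>R x = complex_of_real r *\<^sub>C x"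
    and cinner_commute: "cinner x y = cnj (cinner y x)"
    and cinner_add_left: "cinner (x + y) z = cinner x z + cinner y z"
    and cinner_scaleC_left: "cinner (c *\<^sub>C x) y = c * cinner x y"
    and inner_eq_Re_cinner: "inner x y = Re (cinner x y)"

instantiation complex :: complex_hilbert_space
begin

definition scaleC_complex :: "complex \<Rightarrow> complex \<Rightarrow> complex"
  where "scaleC_complex c x = c * x"

definition cinner_complex :: "complex \<Rightarrow> complex \<Rightarrow> complex"
  where "cinner_complex x y = x * cnj y"

instance
  by standard
    (simp_all add: scaleC_complex_def cinner_complex_def inner_complex_def algebra_simps scaleR_conv_of_real)

end

text \<open>The algebra \<open>\<L>(\<H>)\<close>. Operators are functions; their sum and difference are pointwise, their
  product is composition, and \<^const>\<open>onorm\<close> is the operator norm.\<close>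

definition bounded_operator :: "('a::complex_hilbert_space \<Rightarrow> 'a) \<Rightarrow> bool"
  where "bounded_operator A \<longleftrightarrow> bounded_linear A \<and> (\<forall>c x. A (c *\<^sub>C x) = c *\<^sub>C A x)"

definition is_adjoint :: "('a::complex_hilbert_space \<Rightarrow> 'a) \<Rightarrow> ('a \<Rightarrow> 'a) \<Rightarrow> bool"
  where "is_adjoint A B \<longleftrightarrow> (\<forall>x y. cinner (A x) y = cinner x (B y))"

definition selfadjoint_operator :: "('a::complex_hilbert_space \<Rightarrow> 'a) \<Rightarrow> bool"
  where "selfadjoint_operator A \<longleftrightarrow> bounded_operator A \<and> is_adjoint A A"

definition positive_operator :: "('a::complex_hilbert_space \<Rightarrow> 'a) \<Rightarrow> bool"
  where "positive_operator A \<longleftrightarrow> bounded_operator A \<and> (\<forall>x. cinner (A x) x \<in> \<real>\<^sub>\<ge>\<^sub>0)"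

definition invertible_operator :: "('a::complex_hilbert_space \<Rightarrow> 'a) \<Rightarrow> bool"
  where "invertible_operator A \<longleftrightarrow>
    bounded_operator A \<and> (\<exists>B. bounded_operator B \<and> B \<circ> A = id \<and> A \<circ> B = id)"

definition spectrum :: "('a::complex_hilbert_space \<Rightarrow> 'a) \<Rightarrow> complex set"
  where "spectrum A = {c. \<not> invertible_operator (\<lambda>x. c *\<^sub>C x - A x)}"

text \<open>The spectrum of a bounded operator is nonempty unless the space is trivial; inserting \<open>0\<close>
  only serves to give the operator on the zero space spectral radius \<open>0\<close>.\<close>

definition spectral_radius :: "('a::complex_hilbert_space \<Rightarrow> 'a) \<Rightarrow> real"
  where "spectral_radius A = Sup (insert 0 (cmod ` spectrum A))"

definition orthogonal_projection :: "'a::complex_hilbert_space set \<Rightarrow> 'a \<Rightarrow> 'a"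
  where "orthogonal_projection M x = (THE y. y \<in> M \<and> (\<forall>z\<in>M. cinner (x - y) z = 0))"

definition range_projection :: "('a::complex_hilbert_space \<Rightarrow> 'a) \<Rightarrow> 'a \<Rightarrow> 'a"
  where "range_projection A = orthogonal_projection (closure (range A))"

text \<open>The four Penrose equations. They have a solution in \<open>\<L>(\<H>)\<close>, which is then unique, if and only if
  \<open>A\<close> has closed range; otherwise \<open>pseudoinverse A\<close> is unspecified.\<close>

definition is_pseudoinverse :: "('a::complex_hilbert_space \<Rightarrow> 'a) \<Rightarrow> ('a \<Rightarrow> 'a) \<Rightarrow> bool"
  where "is_pseudoinverse A X \<longleftrightarrow> bounded_operator X \<and> A \<circ> X \<circ> A = A \<and> X \<circ> A \<circ> X = X \<and>
    is_adjoint (A \<circ> X) (A \<circ> X) \<and> is_adjoint (X \<circ> A) (X \<circ> A)"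

definition pseudoinverse :: "('a::complex_hilbert_space \<Rightarrow> 'a) \<Rightarrow> 'a \<Rightarrow> 'a"
  where "pseudoinverse A = (THE X. is_pseudoinverse A X)"

definition proper_splitting ::
  "('a::complex_hilbert_space \<Rightarrow> 'a) \<Rightarrow> ('a \<Rightarrow> 'a) \<Rightarrow> ('a \<Rightarrow> 'a) \<Rightarrow> bool"
  where "proper_splitting T U V \<longleftrightarrow> bounded_operator U \<and> bounded_operator V \<and> T = U - V \<and>
    range U = range T \<and> U -` {0} = T -` {0}"

definition convergent_proper_splitting ::
  "('a::complex_hilbert_space \<Rightarrow> 'a) \<Rightarrow> ('a \<Rightarrow> 'a) \<Rightarrow> ('a \<Rightarrow> 'a) \<Rightarrow> bool"
  where "convergent_proper_splitting T U V \<longleftrightarrow>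
    proper_splitting T U V \<and> spectral_radius (pseudoinverse U \<circ> V) < 1"

definition MP_proper_splitting_converges :: "('a::complex_hilbert_space \<Rightarrow> 'a) \<Rightarrow> bool"
  where "MP_proper_splitting_converges T \<longleftrightarrow>
    convergent_proper_splitting T (pseudoinverse T) (pseudoinverse T - T)"

definition positive_orthogonal_decomposition ::
  "('a::complex_hilbert_space \<Rightarrow> 'a) \<Rightarrow> ('a \<Rightarrow> 'a) \<Rightarrow> ('a \<Rightarrow> 'a) \<Rightarrow> bool"
  where "positive_orthogonal_decomposition T T\<^sub>1 T\<^sub>2 \<longleftrightarrow>
    positive_operator T\<^sub>1 \<and> positive_operator T\<^sub>2 \<and> T = T\<^sub>1 - T\<^sub>2 \<and>
    (\<forall>x\<in>closure (range T\<^sub>1). \<forall>y\<in>closure (range T\<^sub>2). cinner x y = 0) \<and>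
    {x + y |x y. x \<in> closure (range T\<^sub>1) \<and> y \<in> closure (range T\<^sub>2)} = closure (range T)"

end

theory Submission
  imports Defs
begin

text \<open>
  With \<open>P\<close> the projection onto the closed range of a selfadjoint \<open>A\<close>, the pseudoinverse of the
  pseudoinverse of \<open>A\<close> is \<open>A\<close> itself, so the iteration operator of the MP-proper splitting is
  \<open>A (A\<^sup>\<dagger> - A) = P - A\<^sup>2\<close>; it is selfadjoint, hence its spectral radius is its norm.
  The norm is also the supremum of the modulus of the form \<open>\<parallel>P x\<parallel>\<^sup>2 - \<parallel>A x\<parallel>\<^sup>2\<close>
  over unit vectors. As \<open>A\<close> is bounded below on its closed range, this form stays
  away from 1, so the norm is less than 1 iff the form stays away from \<open>-1\<close>, i.e. iff
  \<open>\<parallel>A\<parallel>\<^sup>2 < 2\<close>. On \<open>\<R>(T\<^sub>i)\<close> the operator \<open>T\<^sub>i\<close> agrees with \<open>\<plusminus>T\<close>, so the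
  same applies to \<open>T\<^sub>1\<close> and \<open>T\<^sub>2\<close>, and orthogonality of the ranges gives
  \<open>\<parallel>T\<parallel> = max \<parallel>T\<^sub>1\<parallel> \<parallel>T\<^sub>2\<parallel>\<close>.
\<close>

section \<open>Symmetric operators on real Hilbert spaces\<close>

text \<open>Uniform boundedness by Baire category: the closed sets \<open>E n\<close> cover the
  space, so one of them contains a ball. Comparing its centre with another of its points bounds the
  norms in \<open>S\<close>.\<close>

lemma weakly_bounded_imp_bounded:
  fixes S :: "'a::{real_inner,banach} set"
  assumes "\<And>y. \<exists>K. \<forall>x\<in>S. \<bar>inner y x\<bar> \<le> K"
  shows "bounded S"
proof -
  define E where "E = (\<lambda>n::nat. {y::'a. \<forall>x\<in>S. \<bar>inner y x\<bar> \<le> real n})"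
  have "closed (E n)" for n
  proof -
    have "E n = (\<Inter>x\<in>S. {y. \<bar>inner y x\<bar> \<le> real n})"
      by (auto simp: E_def)
    then show ?thesis
      by (auto intro!: closed_Collect_le continuous_intros)
  qed
  moreover have "(\<Union>n. E n) = UNIV"
  proof -
    have "y \<in> (\<Union>n. E n)" for y
    proof -
      obtain K where "\<forall>x\<in>S. \<bar>inner y x\<bar> \<le> K" using assms by blast
      moreover obtain n where "K \<le> real n" using real_arch_simple by blast
      ultimately have "y \<in> E n" unfolding E_def by force
      then show ?thesis by blast
    qed
    then show ?thesis by blast
  qed
  ultimately obtain n where "interior (E n) \<noteq> {}"
    using Met_TC.metric_Baire_category_alt[of "range E"] complete_UNIV
    by (force simp: euclidean_interior_of)
  then obtain a where "a \<in> interior (E n)" by blast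
  then obtain r where r: "r > 0" "cball a r \<subseteq> E n"
    unfolding mem_interior_cball by blast
  have "norm x \<le> 2 * real n / r" if "x \<in> S" for x
  proof -
    \<comment> \<open>\<open>x\<close> rescaled to length \<open>r\<close>: then
      \<open>a + u\<close> stays in the ball, while \<open>inner u x\<close> is
      \<open>r * norm x\<close>.\<close>
    define u where "u = (r / norm x) *\<^sub>R x"
    have "norm u \<le> r"
      using r by (simp add: u_def)
    then have "a \<in> E n" "a + u \<in> E n"
      using r by (auto simp: dist_norm subset_iff)
    then have "\<bar>inner a x\<bar> \<le> n" "\<bar>inner (a + u) x\<bar> \<le> n"
      using that by (auto simp: E_def)
    then have "\<bar>inner u x\<bar> \<le> 2 * real n"
      by (simp add: inner_add_left)
    moreover have "inner u x = r * norm x"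
      by (simp add: u_def power2_norm_eq_inner[symmetric] power2_eq_square)
    ultimately show ?thesis
      using r by (simp add: field_simps abs_mult)
  qed
  then show ?thesis by (auto simp: bounded_iff)
qed

text \<open>Rests on uniform boundedness instead of the open mapping theorem: the vectors of the
  range that \<open>A\<close> maps into the unit ball form a bounded set, and scaling turns its
  bound into \<open>m\<close>. Closedness of the range enters as the existence of orthogonal
  projections onto it.\<close>

lemma symmetric_closed_range_bounded_below:
  fixes A :: "'a::{real_inner,banach} \<Rightarrow> 'a"
  assumes A: "bounded_linear A" and sym: "\<And>x y. inner (A x) y = inner x (A y)"
    and "\<And>y. \<exists>p\<in>range A. \<forall>z\<in>range A. inner (y - p) z = 0"
  obtains m where "m > 0" "\<And>x. x \<in> range A \<Longrightarrow> m * norm x \<le> norm (A x)"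
proof -
  interpret A: bounded_linear A by (fact A)
  \<comment> \<open>The set \<open>S\<close> is weakly bounded: testing against \<open>y\<close> is testing against its projection \<open>A z\<close>,
    and \<open>\<langle>A z, x\<rangle> = \<langle>z, A x\<rangle>\<close>.\<close>
  define S where "S = {x \<in> range A. norm (A x) \<le> 1}"
  have "\<exists>K. \<forall>x\<in>S. \<bar>inner y x\<bar> \<le> K" for y
  proof -
    obtain z where z: "\<And>x. x \<in> range A \<Longrightarrow> inner (y - A z) x = 0"
      using assms(3)[of y] by blast
    have "\<bar>inner y x\<bar> \<le> norm z" if "x \<in> S" for x
    proof -
      have "inner y x = inner (A z) x"
        using z[of x] that by (simp add: S_def inner_diff_left)
      also have "\<bar>\<dots>\<bar> \<le> norm z * norm (A x)"
        using Cauchy_Schwarz_ineq2 by (simp add: sym)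
      also have "\<dots> \<le> norm z * 1"
        using that by (intro mult_left_mono) (auto simp: S_def)
      finally show ?thesis by simp
    qed
    then show ?thesis by blast
  qed
  then have "bounded S" by (rule weakly_bounded_imp_bounded)
  then obtain K where K: "K > 0" "\<And>x. x \<in> S \<Longrightarrow> norm x \<le> K"
    by (auto simp: bounded_pos)
  have "norm x / K \<le> norm (A x)" if x: "x \<in> range A" for x
  proof (rule field_le_epsilon)
    \<comment> \<open>The slack \<open>e\<close> keeps the divisor \<open>t\<close> positive, since
      \<open>A x = 0\<close> is not yet excluded.\<close>
    fix e :: real assume "e > 0"
    define t where "t = norm (A x) + e"
    have t: "t > 0" using \<open>e > 0\<close> by (simp add: t_def add_nonneg_pos)
    obtain w where w: "x = A w" using x by blast
    have "(1 / t) *\<^sub>R x \<in> S"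
      using t \<open>e > 0\<close> w unfolding S_def
      by (auto simp: A.scaleR t_def image_iff intro!: exI[of _ "(1 / t) *\<^sub>R w"])
    from K(2)[OF this] have "norm x / K \<le> t"
      using t K(1) by (simp add: field_simps)
    then show "norm x / K \<le> norm (A x) + e" by (simp add: t_def)
  qed
  with K(1) show ?thesis by (intro that[of "1 / K"]) auto
qed

text \<open>The projection theorem: a minimizing sequence for the distance from \<open>x\<close> to
  \<open>M\<close> is Cauchy, and minimality of its limit forces orthogonality.\<close>

lemma orthogonal_decomposition_exists:
  fixes M :: "'a::{real_inner,banach} set"
  assumes M: "subspace M" "closed M"
  shows "\<exists>y\<in>M. \<forall>z\<in>M. inner (x - y) z = 0"
proof -
  define d where "d = infdist x M"
  have ne: "M \<noteq> {}" using subspace_0[OF M(1)] by blast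
  have d_le: "d \<le> norm (x - y)" if "y \<in> M" for y
    using infdist_le[OF that] by (simp add: d_def dist_norm)
  have d0: "d \<ge> 0" by (simp add: d_def infdist_nonneg)
  have "\<exists>y\<in>M. norm (x - y) \<le> d + e" if "e > 0" for e
  proof (rule ccontr)
    assume "\<not> ?thesis"
    then have "d + e \<le> infdist x M"
      by (subst infdist_notempty[OF ne]) (rule cINF_greatest[OF ne], force simp: dist_norm)
    then show False using that by (simp add: d_def)
  qed
  then have "\<forall>n. \<exists>y\<in>M. norm (x - y) \<le> d + 1 / Suc n"
    by simp
  then obtain f where f: "\<And>n. f n \<in> M" "\<And>n. norm (x - f n) \<le> d + 1 / Suc n"
    by metis
  \<comment> \<open>The parallelogram law, combined with the fact that the midpoint of
    \<open>a\<close> and \<open>b\<close> lies in \<open>M\<close> and so has distance at least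
    \<open>d\<close> from \<open>x\<close>.\<close>
  have close: "(norm (a - b))\<^sup>2 \<le> 4 * (d + e)\<^sup>2 - 4 * d\<^sup>2"
    if "a \<in> M" "b \<in> M" "norm (x - a) \<le> d + e" "norm (x - b) \<le> d + e" for a b e
  proof -
    have "(1 / 2) *\<^sub>R (a + b) \<in> M"
      using that M(1) by (simp add: subspace_add subspace_scale)
    then have "d \<le> norm (x - (1 / 2) *\<^sub>R (a + b))" by (rule d_le)
    then have "d\<^sup>2 \<le> (norm (x - (1 / 2) *\<^sub>R (a + b)))\<^sup>2"
      using d0 by (rule power_mono)
    moreover have "(norm (x - a))\<^sup>2 \<le> (d + e)\<^sup>2" "(norm (x - b))\<^sup>2 \<le> (d + e)\<^sup>2"
      using that by (auto intro: power_mono)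
    moreover have "(norm (a - b))\<^sup>2 = 2 * (norm (x - a))\<^sup>2 + 2 * (norm (x - b))\<^sup>2
        - 4 * (norm (x - (1 / 2) *\<^sub>R (a + b)))\<^sup>2"
      by (simp add: power2_norm_eq_inner algebra_simps inner_commute)
    ultimately show ?thesis by linarith
  qed
  have h: "(\<lambda>n. d + 1 / Suc n) \<longlonglongrightarrow> d + 0"
    by (rule tendsto_add[OF tendsto_const LIMSEQ_Suc[OF lim_1_over_n]])
  have lim: "(\<lambda>n. 4 * (d + 1 / Suc n)\<^sup>2 - 4 * d\<^sup>2) \<longlonglongrightarrow> 4 * (d + 0)\<^sup>2 - 4 * d\<^sup>2"
    by (intro tendsto_diff tendsto_mult tendsto_power h tendsto_const)
  have "Cauchy f"
  proof (rule metric_CauchyI)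
    fix e :: real assume "e > 0"
    then have "e\<^sup>2 > 0" by simp
    with lim obtain N where N: "4 * (d + 1 / Suc N)\<^sup>2 - 4 * d\<^sup>2 < e\<^sup>2"
      by (fastforce dest: order_tendstoD(2)[of _ _ _ "e\<^sup>2"] simp: eventually_sequentially)
    have "dist (f m) (f n) < e" if "m \<ge> N" "n \<ge> N" for m n
    proof -
      have *: "norm (x - f k) \<le> d + 1 / Suc N" if "k \<ge> N" for k
      proof -
        have "1 / Suc k \<le> 1 / Suc N" using that by (simp add: field_simps)
        then show ?thesis using f(2)[of k] by linarith
      qed
      have "(norm (f m - f n))\<^sup>2 < e\<^sup>2"
        using close[OF f(1) f(1) *[OF that(1)] *[OF that(2)]] N by linarith
      then show ?thesis
        using \<open>e > 0\<close> power_less_imp_less_base by (fastforce simp: dist_norm)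
    qed
    then show "\<exists>N. \<forall>m\<ge>N. \<forall>n\<ge>N. dist (f m) (f n) < e" by blast
  qed
  then obtain y where y: "f \<longlonglongrightarrow> y"
    using Cauchy_convergent_iff convergent_def by blast
  have yM: "y \<in> M" using closed_sequentially[OF M(2) f(1) y] .
  have "norm (x - y) \<le> d + 0"
  proof (rule LIMSEQ_le)
    show "(\<lambda>n. norm (x - f n)) \<longlonglongrightarrow> norm (x - y)" by (intro tendsto_intros y)
  qed (use f(2) h in auto)
  then have min: "norm (x - y) \<le> norm (x - z)" if "z \<in> M" for z
    using d_le[OF that] by simp
  have "inner (x - y) z = 0" if z: "z \<in> M" for z
  proof (cases "z = 0")
    case False
    \<comment> \<open>The minimizer of the quadratic \<open>norm (x - (y + t *\<^sub>R z))\<close>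
      squared; the decrease it achieves must vanish.\<close>
    define t where "t = inner (x - y) z / inner z z"
    have "y + t *\<^sub>R z \<in> M" using yM z M(1) by (simp add: subspace_add subspace_scale)
    from min[OF this] have "(norm (x - y))\<^sup>2 \<le> (norm (x - (y + t *\<^sub>R z)))\<^sup>2"
      by (simp add: power_mono)
    also have "\<dots> = (norm (x - y))\<^sup>2 - 2 * t * inner (x - y) z + t\<^sup>2 * inner z z"
      by (simp add: power2_norm_eq_inner algebra_simps inner_commute power2_eq_square[of t])
    also have "\<dots> = (norm (x - y))\<^sup>2 - (inner (x - y) z)\<^sup>2 / inner z z"
      using False by (simp add: t_def field_simps power2_eq_square)
    finally have "(inner (x - y) z)\<^sup>2 / inner z z \<le> 0" by simp
    moreover have "inner z z > 0" using False by simp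
    ultimately show ?thesis
      by (simp add: divide_le_0_iff)
  qed simp
  with yM show ?thesis by blast
qed

text \<open>Polarization: symmetry expresses \<open>inner (A x) y\<close> by values of the form at
  \<open>x + y\<close> and \<open>x - y\<close>. Taking \<open>y\<close> as \<open>A x\<close>
  rescaled to the length of \<open>x\<close>, the parallelogram law gives the bound.\<close>

lemma symmetric_onorm_le:
  fixes A :: "'a::real_inner \<Rightarrow> 'a"
  assumes A: "bounded_linear A" and sym: "\<And>x y. inner (A x) y = inner x (A y)"
    and q: "0 \<le> q" "\<And>x. \<bar>inner (A x) x\<bar> \<le> q * (norm x)\<^sup>2"
  shows "onorm A \<le> q"
proof (rule onorm_bound[OF q(1)])
  fix x
  interpret A: bounded_linear A by (fact A)
  show "norm (A x) \<le> q * norm x"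
  proof (cases "A x = 0 \<or> x = 0")
    case False
    define y where "y = (norm x / norm (A x)) *\<^sub>R A x"
    have ny: "norm y = norm x" using False by (simp add: y_def)
    have "inner (A x) y = norm x * norm (A x)"
      using False by (simp add: y_def power2_norm_eq_inner[symmetric] power2_eq_square)
    moreover have "4 * inner (A x) y = inner (A (x + y)) (x + y) - inner (A (x - y)) (x - y)"
      by (simp add: A.add A.diff algebra_simps sym[of y x] inner_commute[of y])
    moreover have "\<dots> \<le> q * (norm (x + y))\<^sup>2 + q * (norm (x - y))\<^sup>2"
      using q(2)[of "x + y"] q(2)[of "x - y"] by linarith
    moreover have "q * (norm (x + y))\<^sup>2 + q * (norm (x - y))\<^sup>2
        = q * (2 * (norm x)\<^sup>2 + 2 * (norm y)\<^sup>2)"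
      by (simp add: power2_norm_eq_inner algebra_simps)
    ultimately have "4 * (norm x * norm (A x)) \<le> 4 * (norm x * (q * norm x))"
      by (simp add: ny power2_eq_square algebra_simps)
    then show ?thesis using False by simp
  qed (use q in auto)
qed

lemma onorm_projection_diff_square_less_1_iff:
  fixes A P :: "'a::real_inner \<Rightarrow> 'a"
  assumes A: "bounded_linear A" and sym: "\<And>x y. inner (A x) y = inner x (A y)"
    and P: "bounded_linear P" "\<And>x y. inner (P x) y = inner x (P y)" "\<And>x. P (P x) = P x"
    and AP: "\<And>x. A (P x) = A x"
    and m: "0 < m" "\<And>x. m * norm (P x) \<le> norm (A x)"
  shows "onorm (P - A ^^ 2) < 1 \<longleftrightarrow> onorm A < sqrt 2"
proof -
  define B where "B = P - A ^^ 2"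
  have B: "B x = P x - A (A x)" for x by (simp add: B_def numeral_2_eq_2)
  have bl: "bounded_linear B"
    unfolding B[abs_def] by (intro bounded_linear_intros bounded_linear_compose[OF A] A P)
  have form: "inner (B x) x = (norm (P x))\<^sup>2 - (norm (A x))\<^sup>2" for x
    by (simp add: B inner_diff_left power2_norm_eq_inner P sym)
  have Pn: "norm (P x) \<le> norm x" for x
  proof -
    have "(norm (P x))\<^sup>2 = inner (P x) x"
      by (metis P(2,3) power2_norm_eq_inner)
    also have "\<dots> \<le> norm (P x) * norm x" by (rule norm_cauchy_schwarz)
    finally show ?thesis by (cases "P x = 0") (auto simp: power2_eq_square)
  qed
  show ?thesis
  proof
    assume l: "onorm (P - A ^^ 2) < 1"
    define q where "q = onorm B"
    have q: "0 \<le> q" "q < 1" using l onorm_pos_le[OF bl] by (auto simp: q_def B_def)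
    have "onorm A \<le> sqrt (1 + q)"
    proof (rule onorm_bound)
      fix x
      \<comment> \<open>Only the lower bound of the form matters here; it limits how far
        \<open>A\<close> can stretch \<open>x\<close>.\<close>
      have "- inner (B x) x \<le> norm (B x) * norm x"
        using Cauchy_Schwarz_ineq2[of "B x" x] by linarith
      also have "\<dots> \<le> (q * norm x) * norm x"
        unfolding q_def by (intro mult_right_mono onorm bl) auto
      finally have "(norm (A x))\<^sup>2 \<le> (norm (P x))\<^sup>2 + q * (norm x)\<^sup>2"
        by (simp add: form power2_eq_square)
      also have "\<dots> \<le> (norm x)\<^sup>2 + q * (norm x)\<^sup>2"
        using Pn by (simp add: power_mono)
      also have "\<dots> = (sqrt (1 + q) * norm x)\<^sup>2"
        using q by (simp add: power_mult_distrib algebra_simps)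
      finally have "(norm (A x))\<^sup>2 \<le> (sqrt (1 + q) * norm x)\<^sup>2" .
      then show "norm (A x) \<le> sqrt (1 + q) * norm x"
        by (rule power2_le_imp_le) (simp add: q(1))
      show "0 \<le> sqrt (1 + q)" by (simp add: q(1))
    qed
    also have "\<dots> < sqrt 2" using q(2) by simp
    finally show "onorm A < sqrt 2" .
  next
    assume l: "onorm A < sqrt 2"
    define a where "a = (onorm A)\<^sup>2"
    have "a < (sqrt 2)\<^sup>2"
      unfolding a_def using l onorm_pos_le[OF A] by (intro power_strict_mono) auto
    then have a: "a < 2" by simp
    \<comment> \<open>The form at \<open>x\<close> lies between \<open>1 - a\<close> and
      \<open>1 - m\<^sup>2\<close> times the square of \<open>norm (P x)\<close>. The
      \<open>0\<close> keeps \<open>q\<close> nonnegative when both other terms are negative, as for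
      \<open>A = 0\<close> and \<open>m > 1\<close>.\<close>
    define q where "q = max 0 (max (a - 1) (1 - m\<^sup>2))"
    have q: "0 \<le> q" "q < 1" using a m by (auto simp: q_def)
    have "onorm B \<le> q"
    proof (rule symmetric_onorm_le[OF bl _ q(1)])
      show "inner (B x) y = inner x (B y)" for x y
        by (simp add: B inner_diff_left inner_diff_right P sym)
      fix x
      have "norm (A x) \<le> onorm A * norm (P x)"
        using onorm[OF A, of "P x"] by (simp add: AP)
      then have "(norm (A x))\<^sup>2 \<le> a * (norm (P x))\<^sup>2"
        unfolding a_def power_mult_distrib[symmetric] by (simp add: power_mono)
      moreover have "m\<^sup>2 * (norm (P x))\<^sup>2 \<le> (norm (A x))\<^sup>2"
        using m unfolding power_mult_distrib[symmetric] by (simp add: power_mono)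
      moreover have "(a - 1) * (norm (P x))\<^sup>2 \<le> q * (norm (P x))\<^sup>2"
        "(1 - m\<^sup>2) * (norm (P x))\<^sup>2 \<le> q * (norm (P x))\<^sup>2"
        by (auto intro!: mult_right_mono simp: q_def)
      ultimately have "\<bar>inner (B x) x\<bar> \<le> q * (norm (P x))\<^sup>2"
        by (auto simp: form algebra_simps abs_le_iff)
      also have "\<dots> \<le> q * (norm x)\<^sup>2"
        using q Pn by (simp add: mult_left_mono power_mono)
      finally show "\<bar>inner (B x) x\<bar> \<le> q * (norm x)\<^sup>2" .
    qed
    with q show "onorm (P - A ^^ 2) < 1" by (simp add: B_def)
  qed
qed

section \<open>Selfadjoint operators and their range projections\<close>

lemma cinner_diff_left: "cinner (x - y) z = cinner x z - cinner y z"
  using cinner_add_left[of "x - y" y z] by simp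

lemma cinner_add_right: "cinner x (y + z) = cinner x y + cinner x z"
  by (metis cinner_add_left cinner_commute complex_cnj_add)

lemma cinner_scaleC_right: "cinner x (c *\<^sub>C y) = cnj c * cinner x y"
  by (metis cinner_scaleC_left cinner_commute complex_cnj_mult)

text \<open>Recovers the complex inner product from its real part, so that facts about real inner
  products transfer.\<close>

lemma cinner_eq_Complex: "cinner x y = Complex (inner x y) (inner x (\<i> *\<^sub>C y))"
  by (simp add: complex_eq_iff inner_eq_Re_cinner cinner_scaleC_right)

lemma norm_scaleC: "norm (c *\<^sub>C x) = cmod c * norm x"
proof -
  have "(norm (c *\<^sub>C x))\<^sup>2 = Re (c * cnj c * cinner x x)"
    by (simp only: power2_norm_eq_inner inner_eq_Re_cinner cinner_scaleC_left
        cinner_scaleC_right mult.assoc mult.left_commute)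
  also have "\<dots> = (cmod c * norm x)\<^sup>2"
    by (simp add: complex_norm_square[symmetric] power_mult_distrib power2_norm_eq_inner
        inner_eq_Re_cinner del: of_real_power)
  finally show ?thesis by simp
qed

lemma bounded_linear_scaleC: "bounded_linear (\<lambda>x. c *\<^sub>C x)"
  by (rule bounded_linear_intro[where K = "cmod c"])
    (simp_all add: scaleC_add_right scaleR_eq_scaleC scaleC_scaleC norm_scaleC mult.commute)

lemma scaleC_diff_right: "c *\<^sub>C (x - y) = c *\<^sub>C x - c *\<^sub>C y"
  using scaleC_add_right[of c "x - y" y] by simp

text \<open>Makes the lemmas on real Hilbert spaces applicable: the imaginary part is a real inner
  product with \<open>\<i> *\<^sub>C y\<close>, and \<open>B\<close> commutes with multiplication by
  \<open>\<i>\<close>.\<close>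

lemma is_adjoint_iff_inner:
  assumes "bounded_operator B"
  shows "is_adjoint A B \<longleftrightarrow> (\<forall>x y. inner (A x) y = inner x (B y))"
proof
  assume "is_adjoint A B"
  then show "\<forall>x y. inner (A x) y = inner x (B y)"
    by (simp add: is_adjoint_def inner_eq_Re_cinner)
next
  assume *: "\<forall>x y. inner (A x) y = inner x (B y)"
  have "cinner (A x) y = cinner x (B y)" for x y
  proof -
    have "cinner (A x) y = Complex (inner x (B y)) (inner x (B (\<i> *\<^sub>C y)))"
      using * by (simp only: cinner_eq_Complex)
    also have "B (\<i> *\<^sub>C y) = \<i> *\<^sub>C B y"
      using assms by (simp only: bounded_operator_def)
    finally show ?thesis by (simp only: cinner_eq_Complex)
  qed
  then show "is_adjoint A B" by (simp only: is_adjoint_def simp_thms)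
qed

lemma selfadjoint_operator_iff_inner:
  "selfadjoint_operator A \<longleftrightarrow> bounded_operator A \<and> (\<forall>x y. inner (A x) y = inner x (A y))"
  using is_adjoint_iff_inner unfolding selfadjoint_operator_def by blast

lemma selfadjoint_operatorD:
  assumes "selfadjoint_operator A"
  shows "bounded_linear A" "A (c *\<^sub>C x) = c *\<^sub>C A x" "inner (A x) y = inner x (A y)"
  using assms by (auto simp: selfadjoint_operator_iff_inner bounded_operator_def)

text \<open>Only reality of the form is used. Expanding it at \<open>x + y\<close> relates the
  imaginary parts of \<open>cinner (A x) y\<close> and \<open>cinner (A y) x\<close>; replacing
  \<open>y\<close> by \<open>\<i> *\<^sub>C y\<close> relates the real parts.\<close>

lemma positive_operator_imp_selfadjoint:
  assumes "positive_operator A"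
  shows "selfadjoint_operator A"
  unfolding selfadjoint_operator_def is_adjoint_def
proof (intro conjI allI)
  show bo: "bounded_operator A" using assms by (simp add: positive_operator_def)
  then interpret A: bounded_linear A by (simp add: bounded_operator_def)
  have im: "Im (cinner (A x) x) = 0" for x
    using assms by (auto simp: positive_operator_def complex_nonneg_Reals_iff)
  fix x y
  have *: "Im (cinner (A x) y) + Im (cinner (A y) x) = 0" for x y
    using im[of "x + y"] im[of x] im[of y] by (simp add: A.add cinner_add_left cinner_add_right)
  have "Im (cinner (A x) (\<i> *\<^sub>C y)) + Im (cinner (A (\<i> *\<^sub>C y)) x) = 0" by (rule *)
  moreover have "A (\<i> *\<^sub>C y) = \<i> *\<^sub>C A y" using bo by (simp add: bounded_operator_def)
  ultimately have "Re (cinner (A x) y) = Re (cinner (A y) x)"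
    by (simp add: cinner_scaleC_left cinner_scaleC_right)
  then have "cinner (A x) y = cnj (cinner (A y) x)"
    using *[of x y] by (simp add: complex_eq_iff)
  then show "cinner (A x) y = cinner x (A y)" using cinner_commute[of x] by simp
qed

lemma orthogonal_projection_eqI:
  assumes "subspace M" "y \<in> M" "\<And>z. z \<in> M \<Longrightarrow> cinner (x - y) z = 0"
  shows "orthogonal_projection M x = y"
  unfolding orthogonal_projection_def
proof (rule the_equality)
  fix w assume w: "w \<in> M \<and> (\<forall>z\<in>M. cinner (x - w) z = 0)"
  have "w - y \<in> M" using assms w by (simp add: subspace_diff)
  then have "cinner (x - y) (w - y) - cinner (x - w) (w - y) = 0"
    using assms(3) w by simp
  then have "cinner (w - y) (w - y) = 0"
    by (simp add: cinner_diff_left)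
  then show "w = y"
    using inner_eq_Re_cinner[of "w - y" "w - y"] by simp
qed (use assms in auto)

lemma subspace_closure:
  fixes S :: "'a::real_normed_vector set"
  assumes "subspace S"
  shows "subspace (closure S)"
proof (rule subspaceI)
  show "0 \<in> closure S" using subspace_0[OF assms] closure_subset by blast
next
  fix x y assume "x \<in> closure S" "y \<in> closure S"
  then obtain f g where "\<forall>n::nat. f n \<in> S" "f \<longlonglongrightarrow> x" "\<forall>n::nat. g n \<in> S" "g \<longlonglongrightarrow> y"
    unfolding closure_sequential by blast
  then have "\<forall>n. f n + g n \<in> S" "(\<lambda>n. f n + g n) \<longlonglongrightarrow> x + y"
    by (auto intro: subspace_add assms tendsto_add)
  then show "x + y \<in> closure S"
    unfolding closure_sequential by (intro exI[of _ "\<lambda>n. f n + g n"] conjI)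
next
  fix c x assume "x \<in> closure S"
  then obtain f where "\<forall>n::nat. f n \<in> S" "f \<longlonglongrightarrow> x"
    unfolding closure_sequential by blast
  then have "\<forall>n. c *\<^sub>R f n \<in> S" "(\<lambda>n. c *\<^sub>R f n) \<longlonglongrightarrow> c *\<^sub>R x"
    by (auto intro: subspace_scale assms tendsto_intros)
  then show "c *\<^sub>R x \<in> closure S"
    unfolding closure_sequential by (intro exI[of _ "\<lambda>n. c *\<^sub>R f n"] conjI)
qed

section \<open>The range projection of a selfadjoint operator\<close>

locale selfadjoint_range =
  fixes A :: "'a::complex_hilbert_space \<Rightarrow> 'a"
  assumes A: "selfadjoint_operator A"
begin

sublocale A: bounded_linear A
  using A by (rule selfadjoint_operatorD)

lemmas A_scaleC = selfadjoint_operatorD(2)[OF A]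
lemmas A_sym = selfadjoint_operatorD(3)[OF A]

text \<open>The closure is taken because the locale also serves \<open>T\<^sub>1\<close> and
  \<open>T\<^sub>2\<close>, whose ranges are not assumed closed.\<close>

abbreviation M where "M \<equiv> closure (range A)"

abbreviation P where "P \<equiv> range_projection A"

lemma subspace_M: "subspace M"
  by (intro subspace_closure linear_subspace_image A.linear_axioms subspace_UNIV)

lemma scaleC_M: "c *\<^sub>C x \<in> M" if "x \<in> M"
proof -
  have "(\<lambda>x. c *\<^sub>C x) ` range A \<subseteq> range A"
    by (auto simp flip: A_scaleC)
  then have "(\<lambda>x. c *\<^sub>C x) ` M \<subseteq> M"
    using closure_bounded_linear_image_subset[OF bounded_linear_scaleC, of c "range A"]
      closure_mono by blast
  then show ?thesis using that by blast
qed

text \<open>\<open>M\<close> is a complex subspace, so real orthogonality can be tested at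
  \<open>\<i> *\<^sub>C z\<close> as well.\<close>

lemma cinner_eq_0_on_M:
  assumes "\<And>z. z \<in> M \<Longrightarrow> inner x z = 0" "z \<in> M"
  shows "cinner x z = 0"
  unfolding cinner_eq_Complex assms(1)[OF assms(2)] assms(1)[OF scaleC_M[OF assms(2)]]
  by (simp add: complex_eq_iff)

lemma P_eqI:
  assumes "y \<in> M" "\<And>z. z \<in> M \<Longrightarrow> inner (x - y) z = 0"
  shows "P x = y"
  unfolding range_projection_def
  using subspace_M assms(1) cinner_eq_0_on_M[OF assms(2)] by (rule orthogonal_projection_eqI)

lemma P_in: "P x \<in> M" and P_orth: "z \<in> M \<Longrightarrow> inner (x - P x) z = 0"
proof -
  obtain y where y: "y \<in> M" "\<And>z. z \<in> M \<Longrightarrow> inner (x - y) z = 0"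
    using orthogonal_decomposition_exists[OF subspace_M closed_closure] by metis
  then have "P x = y" by (rule P_eqI)
  with y show "P x \<in> M" "z \<in> M \<Longrightarrow> inner (x - P x) z = 0" by auto
qed

lemma P_id: "x \<in> M \<Longrightarrow> P x = x"
  by (rule P_eqI) auto

lemma P_A: "P (A x) = A x"
  using closure_subset[of "range A"] by (intro P_id) blast

lemma P_sym: "inner (P x) y = inner x (P y)"
proof -
  have "inner x (P y) = inner (P x) (P y)" for x y
    using P_orth[where z = "P y" and x = x] P_in[of y] by (simp add: inner_diff_left)
  from this[of x y] this[of y x] show ?thesis by (metis inner_commute)
qed

text \<open>Each linearity law follows from the uniqueness in \<open>P_eqI\<close>; the bound is
  Cauchy-Schwarz for \<open>inner (P x) x\<close>.\<close>

lemma P_bounded: "bounded_operator P"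
  unfolding bounded_operator_def
proof (intro conjI allI bounded_linear_intro[where K = 1])
  note sub = subspace_M
  fix x y c r
  show "P (x + y) = P x + P y"
  proof (rule P_eqI)
    show "P x + P y \<in> M" by (intro subspace_add sub P_in)
    fix z assume "z \<in> M"
    then show "inner (x + y - (P x + P y)) z = 0"
      using P_orth[of z x] P_orth[of z y] by (simp add: inner_diff_left inner_add_left)
  qed
  show scC: "P (c *\<^sub>C x) = c *\<^sub>C P x" for c x
  proof (rule P_eqI)
    show "c *\<^sub>C P x \<in> M" by (intro scaleC_M P_in)
    fix z assume "z \<in> M"
    have "inner (c *\<^sub>C x - c *\<^sub>C P x) z = inner (x - P x) (cnj c *\<^sub>C z)"
      by (simp add: inner_eq_Re_cinner cinner_diff_left cinner_scaleC_left cinner_scaleC_right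
          algebra_simps)
    then show "inner (c *\<^sub>C x - c *\<^sub>C P x) z = 0"
      using P_orth[OF scaleC_M[OF \<open>z \<in> M\<close>], of x "cnj c"] by simp
  qed
  show "P (r *\<^sub>R x) = r *\<^sub>R P x" by (simp add: scaleR_eq_scaleC scC)
  have "(norm (P x))\<^sup>2 = inner (P x) x"
    by (metis P_sym P_id P_in power2_norm_eq_inner)
  also have "\<dots> \<le> norm (P x) * norm x" by (rule norm_cauchy_schwarz)
  finally show "norm (P x) \<le> norm x * 1" by (cases "P x = 0") (auto simp: power2_eq_square)
qed

lemma P_selfadjoint: "selfadjoint_operator P"
  using P_bounded P_sym by (simp add: selfadjoint_operator_iff_inner)

lemma A_eq_0_iff: "A x = 0 \<longleftrightarrow> (\<forall>z\<in>M. inner x z = 0)"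
proof
  assume "A x = 0"
  then have "range A \<subseteq> {z. inner x z = 0}" by (auto simp flip: A_sym)
  moreover have "closed {z. inner x z = 0}"
    by (intro closed_Collect_eq continuous_intros)
  ultimately show "\<forall>z\<in>M. inner x z = 0"
    using closure_minimal[of "range A"] by blast
next
  assume *: "\<forall>z\<in>M. inner x z = 0"
  have "inner (A x) (A x) = inner x (A (A x))" by (rule A_sym)
  also have "\<dots> = 0" using * closure_subset[of "range A"] by blast
  finally show "A x = 0" by simp
qed

lemma A_P: "A (P x) = A x"
proof -
  have "A (x - P x) = 0" using P_orth by (simp add: A_eq_0_iff)
  then show ?thesis by (simp add: A.diff)
qed

lemma closed_range_bounded_below:
  assumes "closed (range A)"
  obtains m where "m > 0" "\<And>x. x \<in> range A \<Longrightarrow> m * norm x \<le> norm (A x)"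
proof (rule symmetric_closed_range_bounded_below[OF A.bounded_linear_axioms A_sym])
  fix y
  show "\<exists>p\<in>range A. \<forall>z\<in>range A. inner (y - p) z = 0"
    using P_in[of y] P_orth[of _ y] by (metis assms closure_closed)
qed blast

text \<open>The hypothesis is a lower bound on \<open>M\<close> rather than a closed range, because
  \<open>T\<^sub>1\<close> and \<open>T\<^sub>2\<close> inherit such a bound directly from
  \<open>T\<close>.\<close>

lemma onorm_P_diff_square_less_1_iff:
  assumes "0 < m" "\<And>x. x \<in> M \<Longrightarrow> m * norm x \<le> norm (A x)"
  shows "onorm (P - A ^^ 2) < 1 \<longleftrightarrow> onorm A < sqrt 2"
proof (rule onorm_projection_diff_square_less_1_iff[where A = A and P = P,
      OF A.bounded_linear_axioms A_sym _ P_sym _ A_P assms(1)])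
  show "bounded_linear P" using P_bounded by (simp add: bounded_operator_def)
  show "P (P x) = P x" for x by (rule P_id[OF P_in])
  show "m * norm (P x) \<le> norm (A x)" for x using assms(2)[OF P_in, of x] by (simp add: A_P)
qed

end

section \<open>The Moore-Penrose inverse\<close>

text \<open>Taking adjoints in \<open>A X = (A Y) (A X)\<close> gives \<open>A X = A Y\<close>, and
  similarly \<open>X A = Y A\<close>; then \<open>X = X A X = X A Y = Y A Y = Y\<close>.\<close>

lemma is_pseudoinverse_unique:
  assumes "is_pseudoinverse A X" "is_pseudoinverse A Y"
  shows "X = Y"
proof -
  have X: "A (X (A x)) = A x" "X (A (X x)) = X x"
    "cinner (A (X x)) y = cinner x (A (X y))" "cinner (X (A x)) y = cinner x (X (A y))" for x y
    using assms(1) unfolding is_pseudoinverse_def is_adjoint_def fun_eq_iff by auto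
  have Y: "A (Y (A x)) = A x" "Y (A (Y x)) = Y x"
    "cinner (A (Y x)) y = cinner x (A (Y y))" "cinner (Y (A x)) y = cinner x (Y (A y))" for x y
    using assms(2) unfolding is_pseudoinverse_def is_adjoint_def fun_eq_iff by auto
  have ext: "u = v" if "\<And>y. cinner u y = cinner v y" for u v :: 'a
    using that[of "u - v"] inner_eq_Re_cinner[of "u - v" "u - v"] by (simp add: cinner_diff_left)
  have AX: "A (X x) = A (Y x)" for x
  proof (rule ext)
    fix y
    have "cinner (A (X x)) y = cinner (A (Y (A (X x)))) y" by (simp only: Y(1))
    also have "\<dots> = cinner x (A (X (A (Y y))))" by (simp only: Y(3) X(3))
    also have "\<dots> = cinner (A (Y x)) y" by (simp only: X(1) Y(3))
    finally show "cinner (A (X x)) y = cinner (A (Y x)) y" .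
  qed
  have XA: "X (A x) = Y (A x)" for x
  proof (rule ext)
    fix y
    have "cinner (X (A x)) y = cinner (X (A (Y (A x)))) y" by (simp only: Y(1))
    also have "\<dots> = cinner x (Y (A (X (A y))))" by (simp only: Y(4) X(4))
    also have "\<dots> = cinner (Y (A x)) y" by (simp only: X(1) Y(4))
    finally show "cinner (X (A x)) y = cinner (Y (A x)) y" .
  qed
  show ?thesis
  proof
    fix x
    have "X x = X (A (X x))" by (simp only: X(2))
    also have "\<dots> = Y (A (Y x))" by (simp only: AX XA)
    finally show "X x = Y x" by (simp only: Y(2))
  qed
qed

lemma pseudoinverse_eqI: "is_pseudoinverse A X \<Longrightarrow> pseudoinverse A = X"
  unfolding pseudoinverse_def using is_pseudoinverse_unique by blast

text \<open>The Penrose equations are symmetric in both operators; this identifies the pseudoinverse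
  of the pseudoinverse.\<close>

lemma is_pseudoinverse_sym:
  "bounded_operator A \<Longrightarrow> is_pseudoinverse A X \<Longrightarrow> is_pseudoinverse X A"
  by (auto simp: is_pseudoinverse_def)

section \<open>Invertibility and the spectral radius\<close>

lemma bounded_operator_diff:
  "bounded_operator A \<Longrightarrow> bounded_operator B \<Longrightarrow> bounded_operator (\<lambda>x. A x - B x)"
  unfolding bounded_operator_def
  by (auto intro: bounded_linear_sub simp: scaleC_diff_right)

lemma bounded_operator_scaleC: "bounded_operator (\<lambda>x. c *\<^sub>C x)"
  by (simp add: bounded_operator_def bounded_linear_scaleC scaleC_scaleC mult.commute)

text \<open>\<open>C\<close> is injective on \<open>N\<close>, so linearity of \<open>D\<close>
  passes to the solution \<open>B\<close> of \<open>C B = D\<close>. Serves both for inverses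
  (\<open>N = UNIV\<close>, \<open>D = id\<close>) and for the pseudoinverse (\<open>N = M\<close>,
  \<open>D = P\<close>).\<close>

lemma bounded_operator_of_bounded_below:
  assumes C: "bounded_operator C" and "0 < m" and below: "\<And>x. x \<in> N \<Longrightarrow> m * norm x \<le> norm (C x)"
    and N: "subspace N" "\<And>c x. x \<in> N \<Longrightarrow> c *\<^sub>C x \<in> N"
    and D: "bounded_operator D" and CB: "\<And>y. C (B y) = D y" and BN: "\<And>y. B y \<in> N"
  shows "bounded_operator B"
proof -
  interpret C: bounded_linear C using C by (simp add: bounded_operator_def)
  interpret D: bounded_linear D using D by (simp add: bounded_operator_def)
  have inj: "u = v" if "C u = C v" "u \<in> N" "v \<in> N" for u v
    using below[of "u - v"] that N(1) \<open>0 < m\<close>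
    by (simp add: C.diff subspace_diff mult_le_0_iff)
  have sC: "B (c *\<^sub>C y) = c *\<^sub>C B y" for c y
  proof (rule inj)
    show "C (B (c *\<^sub>C y)) = C (c *\<^sub>C B y)"
      using C D by (simp add: CB bounded_operator_def)
  qed (intro BN N(2))+
  obtain K where K: "\<And>y. norm (D y) \<le> norm y * K" using D.bounded by blast
  have "bounded_linear B"
  proof (rule bounded_linear_intro)
    fix x y r
    show "B (x + y) = B x + B y"
      by (rule inj) (simp_all add: C.add CB D.add BN N(1) subspace_add)
    show "B (r *\<^sub>R x) = r *\<^sub>R B x" by (simp only: scaleR_eq_scaleC sC)
    have "m * norm (B x) \<le> norm x * K"
      using below[OF BN, of x] K[of x] by (simp add: CB)
    then show "norm (B x) \<le> norm x * (K / m)"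
      using \<open>0 < m\<close> by (simp add: field_simps)
  qed
  with sC show ?thesis by (simp add: bounded_operator_def)
qed

lemma invertible_operatorI:
  assumes C: "bounded_operator C" and m: "0 < m" "\<And>x. m * norm x \<le> norm (C x)" and "surj C"
  shows "invertible_operator C"
proof -
  interpret C: bounded_linear C using C by (simp add: bounded_operator_def)
  have "inj C"
  proof (rule injI)
    fix u v assume "C u = C v"
    then show "u = v" using m(2)[of "u - v"] m(1) by (simp add: C.diff mult_le_0_iff)
  qed
  moreover have "bounded_operator (inv C)"
    using C m(1)
  proof (rule bounded_operator_of_bounded_below[where N = UNIV and D = id])
    show "bounded_operator id"
      by (simp add: bounded_operator_def id_def bounded_linear_ident)
  qed (auto simp: m(2) surj_f_inv_f[OF \<open>surj C\<close>])
  ultimately show ?thesis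
    using C \<open>surj C\<close> unfolding invertible_operator_def
    by (intro conjI exI[of _ "inv C"]) (auto simp flip: surj_iff)
qed

lemma invertible_operator_bounded_below:
  assumes "invertible_operator C"
  obtains m where "0 < m" "\<And>x. m * norm x \<le> norm (C x)"
proof -
  obtain B where B: "bounded_linear B" "B \<circ> C = id"
    using assms by (auto simp: invertible_operator_def bounded_operator_def)
  obtain K where K: "K > 0" "\<And>x. norm (B x) \<le> norm x * K"
    using bounded_linear.pos_bounded[OF B(1)] by blast
  have "norm x \<le> norm (C x) * K" for x
    using K(2)[of "C x"] B(2) by (simp add: fun_eq_iff)
  with K(1) show ?thesis by (intro that[of "1 / K"]) (auto simp: field_simps)
qed

text \<open>Surjectivity comes from Banach's fixed point theorem: solving
  \<open>c *\<^sub>C x - A x = y\<close> means finding a fixed point of a contraction with factor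
  \<open>onorm A / cmod c\<close>.\<close>

lemma invertible_scaleC_diff:
  assumes A: "bounded_operator A" and c: "onorm A < cmod c"
  shows "invertible_operator (\<lambda>x. c *\<^sub>C x - A x)"
proof (rule invertible_operatorI)
  interpret A: bounded_linear A using A by (simp add: bounded_operator_def)
  have on: "0 \<le> onorm A" by (rule onorm_pos_le) (rule A.bounded_linear_axioms)
  with c have "c \<noteq> 0" by auto
  show "bounded_operator (\<lambda>x. c *\<^sub>C x - A x)"
    by (intro bounded_operator_diff bounded_operator_scaleC A)
  show "0 < cmod c - onorm A" using c by simp
  show "(cmod c - onorm A) * norm x \<le> norm (c *\<^sub>C x - A x)" for x
    using norm_triangle_ineq2[of "c *\<^sub>C x" "A x"] onorm[OF A.bounded_linear_axioms, of x]
    by (simp add: norm_scaleC algebra_simps)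
  show "surj (\<lambda>x. c *\<^sub>C x - A x)"
    unfolding surj_def
  proof
    fix y
    define f where "f = (\<lambda>x. inverse c *\<^sub>C (y + A x))"
    have "dist (f u) (f v) \<le> (onorm A / cmod c) * dist u v" for u v
    proof -
      interpret S: bounded_linear "\<lambda>x. inverse c *\<^sub>C (x::'a)" by (rule bounded_linear_scaleC)
      have "f u - f v = inverse c *\<^sub>C A (u - v)"
        by (simp add: f_def A.diff S.diff S.add)
      then have "dist (f u) (f v) = norm (A (u - v)) / cmod c"
        by (simp only: dist_norm norm_scaleC norm_inverse divide_inverse mult.commute)
      also have "\<dots> \<le> onorm A * norm (u - v) / cmod c"
        by (intro divide_right_mono onorm A.bounded_linear_axioms) simp
      finally show ?thesis by (simp add: dist_norm)
    qed
    then obtain x where "f x = x"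
      using banach_fix_type[of "onorm A / cmod c" f] on c by (auto simp: \<open>c \<noteq> 0\<close>)
    then have "c *\<^sub>C x = y + A x"
      unfolding f_def using \<open>c \<noteq> 0\<close>
      by (metis right_inverse scaleC_one scaleC_scaleC)
    then show "\<exists>x. y = c *\<^sub>C x - A x" by (intro exI[of _ x]) simp
  qed
qed

text \<open>Invertibility beyond the norm gives one inequality. For the other, the norm
  \<open>n\<close> is attained: \<open>n\<close> or \<open>- n\<close> lies in the spectrum, and for
  \<open>n = 0\<close> the inserted \<open>0\<close> suffices.\<close>

lemma spectral_radius_selfadjoint:
  assumes "selfadjoint_operator A"
  shows "spectral_radius A = onorm A"
proof -
  interpret selfadjoint_range A by unfold_locales (fact assms)
  have bo: "bounded_operator A" using assms by (simp add: selfadjoint_operator_def)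
  note bl = A.bounded_linear_axioms
  define n where "n = onorm A"
  have n0: "0 \<le> n" unfolding n_def by (rule onorm_pos_le[OF bl])
  have le: "cmod c \<le> n" if "c \<in> spectrum A" for c
    using that invertible_scaleC_diff[OF bo, of c] unfolding spectrum_def n_def by force
  have "n \<in> insert 0 (cmod ` spectrum A)"
  proof (cases "n = 0")
    case False
    with n0 have "n > 0" by simp
    \<comment> \<open>Otherwise \<open>A\<^sup>2 - n\<^sup>2\<close> is bounded below, which forces \<open>\<parallel>A\<parallel> < n\<close>.\<close>
    have "complex_of_real n \<in> spectrum A \<or> - complex_of_real n \<in> spectrum A"
    proof (rule ccontr)
      assume "\<not> ?thesis"
      then have inv: "invertible_operator (\<lambda>x. complex_of_real n *\<^sub>C x - A x)"
        "invertible_operator (\<lambda>x. complex_of_real (- n) *\<^sub>C x - A x)"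
        unfolding spectrum_def mem_Collect_eq of_real_minus by blast+
      obtain m where m: "0 < m" "\<And>x. m * norm x \<le> norm (n *\<^sub>R x - A x)"
        using invertible_operator_bounded_below[OF inv(1), folded scaleR_eq_scaleC] by blast
      obtain m' where m': "0 < m'" "\<And>x. m' * norm x \<le> norm ((- n) *\<^sub>R x - A x)"
        using invertible_operator_bounded_below[OF inv(2), folded scaleR_eq_scaleC] by blast
      define k where "k = m' * m"
      have "k > 0" using m m' by (simp add: k_def)
      have k: "k * norm x \<le> norm (A (A x) - n\<^sup>2 *\<^sub>R x)" for x
      proof -
        have "k * norm x \<le> m' * norm (n *\<^sub>R x - A x)"
          using m m' by (simp add: k_def mult.assoc)
        also have "\<dots> \<le> norm ((- n) *\<^sub>R (n *\<^sub>R x - A x) - A (n *\<^sub>R x - A x))"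
          by (rule m')
        also have "(- n) *\<^sub>R (n *\<^sub>R x - A x) - A (n *\<^sub>R x - A x) = A (A x) - n\<^sup>2 *\<^sub>R x"
          by (simp add: A.diff A.scaleR algebra_simps power2_eq_square)
        finally show ?thesis .
      qed
      \<comment> \<open>Found by expanding the square of
        \<open>norm (A (A x) - n\<^sup>2 *\<^sub>R x)\<close>, estimating
        \<open>norm (A (A x))\<close> by \<open>n * norm (A x)\<close>, and solving for
        \<open>norm (A x)\<close>.\<close>
      define q where "q = n\<^sup>2 - k\<^sup>2 / n\<^sup>2"
      have q: "(norm (A x))\<^sup>2 \<le> q * (norm x)\<^sup>2" for x
      proof -
        have "(k * norm x)\<^sup>2 \<le> (norm (A (A x) - n\<^sup>2 *\<^sub>R x))\<^sup>2"
          using k \<open>k > 0\<close> by (intro power_mono) auto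
        also have "\<dots> = (norm (A (A x)))\<^sup>2 - 2 * n\<^sup>2 * (norm (A x))\<^sup>2 + (n\<^sup>2 * norm x)\<^sup>2"
        proof -
          have "inner (A (A x)) x = inner (A x) (A x)" "inner x (A (A x)) = inner (A x) (A x)"
            by (rule A_sym, rule A_sym[symmetric])
          then show ?thesis
            unfolding power_mult_distrib power2_norm_eq_inner inner_diff_left inner_diff_right
            by (simp add: power2_eq_square[of "n\<^sup>2"] algebra_simps)
        qed
        finally have "(k * norm x)\<^sup>2 \<le> \<dots>" .
        moreover have "(norm (A (A x)))\<^sup>2 \<le> (n * norm (A x))\<^sup>2"
          unfolding n_def by (intro power_mono onorm bl) simp
        moreover have "(n * norm (A x))\<^sup>2 = n\<^sup>2 * (norm (A x))\<^sup>2"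
          by (rule power_mult_distrib)
        moreover have "n\<^sup>2 * (q * (norm x)\<^sup>2) = (n\<^sup>2 * norm x)\<^sup>2 - (k * norm x)\<^sup>2"
          using \<open>n > 0\<close> by (simp add: q_def field_simps power2_eq_square)
        ultimately have "n\<^sup>2 * (norm (A x))\<^sup>2 \<le> n\<^sup>2 * (q * (norm x)\<^sup>2)" by linarith
        then show ?thesis using \<open>n > 0\<close> by simp
      qed
      have "n \<le> sqrt (max 0 q)"
        unfolding n_def
      proof (rule onorm_bound)
        fix x
        have "(norm (A x))\<^sup>2 \<le> max 0 q * (norm x)\<^sup>2"
          by (rule order_trans[OF q mult_right_mono]) auto
        also have "\<dots> = (sqrt (max 0 q) * norm x)\<^sup>2"
          by (simp only: power_mult_distrib real_sqrt_pow2[OF max.cobounded1])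
        finally show "norm (A x) \<le> sqrt (max 0 q) * norm x"
          by (rule power2_le_imp_le)
            (intro mult_nonneg_nonneg real_sqrt_ge_zero max.cobounded1 norm_ge_zero)
      qed (intro real_sqrt_ge_zero max.cobounded1)
      also have "\<dots> < n"
      proof -
        have "0 < k\<^sup>2 / n\<^sup>2" "0 < n\<^sup>2" using \<open>n > 0\<close> \<open>k > 0\<close> by simp_all
        then have "max 0 q < n\<^sup>2" unfolding q_def by linarith
        then show ?thesis by (rule real_less_lsqrt[OF order_less_imp_le[OF \<open>n > 0\<close>]])
      qed
      finally show False by simp
    qed
    moreover have "cmod (complex_of_real n) = n" "cmod (- complex_of_real n) = n"
      using n0 by simp_all
    ultimately show ?thesis by (metis image_eqI insertI2)
  qed simp
  then show ?thesis
    unfolding spectral_radius_def n_def[symmetric]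
    by (rule cSup_eq_maximum) (use le n0 in auto)
qed

section \<open>The MP-proper splitting\<close>

context selfadjoint_range
begin

text \<open>\<open>X y\<close> is the solution of \<open>A x = P y\<close> that lies in
  \<open>M\<close>; it is unique there, as \<open>A\<close> is bounded below on its closed
  range.\<close>

lemma pseudoinverse_exists:
  assumes cl: "closed (range A)"
  obtains X where "is_pseudoinverse A X" "A \<circ> X = P" "X \<circ> A = P" "X \<circ> P = X"
proof -
  obtain m where m: "m > 0" "\<And>x. x \<in> range A \<Longrightarrow> m * norm x \<le> norm (A x)"
    using closed_range_bounded_below[OF cl] by blast
  have M: "M = range A" using cl by simp
  \<comment> \<open>Any preimage \<open>z\<close> of \<open>P y\<close> can be moved into
    \<open>M\<close> by projecting, since \<open>A (P z) = A z\<close>.\<close>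
  have "\<exists>x. x \<in> M \<and> A x = P y" for y
  proof -
    obtain z where "P y = A z" using P_in[of y] by (auto simp: M)
    then show ?thesis by (intro exI[of _ "P z"]) (simp add: A_P P_in)
  qed
  then obtain X where X: "\<And>y. X y \<in> M" "\<And>y. A (X y) = P y" by metis
  have "bounded_operator A" using A by (simp add: selfadjoint_operator_def)
  then have bo: "bounded_operator X"
    using m(1) _ subspace_M scaleC_M P_bounded X(2,1)
    by (rule bounded_operator_of_bounded_below) (use m(2) M in simp)
  have inj: "u = v" if "A u = A v" "u \<in> M" "v \<in> M" for u v
    using m(2)[of "u - v"] that m(1) subspace_diff[OF subspace_M that(2,3)]
    by (simp add: A.diff M mult_le_0_iff)
  have XA: "X (A x) = P x" for x
    by (rule inj) (simp_all add: X P_A A_P P_in)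
  have XP: "X (P x) = X x" for x
    by (rule inj) (simp_all add: X P_id P_in)
  have PX: "P (X x) = X x" for x by (rule P_id[OF X(1)])
  have "A \<circ> X = P" "X \<circ> A = P" "X \<circ> P = X" by (simp_all add: fun_eq_iff X XA XP)
  moreover from this have "is_pseudoinverse A X"
    unfolding is_pseudoinverse_def using P_selfadjoint bo PX
    by (simp add: selfadjoint_operator_def) (simp add: fun_eq_iff P_A)
  ultimately show ?thesis using that by blast
qed

text \<open>Convergence includes properness of the splitting, shown first: as \<open>A X\<close> and
  \<open>X A\<close> are both \<open>P\<close>, the operators \<open>A\<close> and \<open>X\<close>
  share range and nullspace.\<close>

lemma MP_proper_splitting_converges_iff:
  assumes cl: "closed (range A)"
  shows "MP_proper_splitting_converges A \<longleftrightarrow> onorm A < sqrt 2"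
proof -
  obtain X where X: "is_pseudoinverse A X" "A \<circ> X = P" "X \<circ> A = P" "X \<circ> P = X"
    using pseudoinverse_exists[OF cl] .
  have AX: "A (X x) = P x" and XA: "X (A x) = P x" and XP: "X (P x) = X x" for x
    using X(2-4) by (auto simp: fun_eq_iff)
  have XAX: "P (X x) = X x" for x
    using X(1) XA by (auto simp: is_pseudoinverse_def fun_eq_iff)
  have bo: "bounded_operator A" "bounded_operator X"
    using A X(1) by (simp_all add: selfadjoint_operator_def is_pseudoinverse_def)
  have pX: "pseudoinverse A = X" "pseudoinverse X = A"
    using X(1) bo(1) by (simp_all add: pseudoinverse_eqI is_pseudoinverse_sym)
  have M: "M = range A" using cl by simp
  interpret X: bounded_linear X using bo(2) by (simp add: bounded_operator_def)
  have "proper_splitting A X (X - A)"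
    unfolding proper_splitting_def
  proof (intro conjI)
    show "bounded_operator (X - A)"
      unfolding fun_diff_def by (intro bounded_operator_diff bo)
    show "A = X - (X - A)" by (simp add: fun_eq_iff)
    show "range X = range A"
    proof
      show "range X \<subseteq> range A" using P_in by (metis M XAX image_subsetI)
      show "range A \<subseteq> range X" using P_A XA by (metis image_subsetI rangeI)
    qed
    have "X y = 0 \<longleftrightarrow> A y = 0" for y
    proof
      assume "X y = 0"
      then have "P y = 0" by (simp flip: AX)
      then show "A y = 0" by (metis A_P A.zero)
    next
      assume "A y = 0"
      then have "P y = 0" by (simp flip: XA)
      then show "X y = 0" by (metis XP X.zero)
    qed
    then show "X -` {0} = A -` {0}" by auto
  qed (rule bo)
  moreover have "A \<circ> (X - A) = P - A ^^ 2"
    by (simp add: fun_eq_iff A.diff AX numeral_2_eq_2)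
  moreover have "selfadjoint_operator (P - A ^^ 2)"
  proof -
    have *: "(P - A ^^ 2) x = P x - A (A x)" for x by (simp add: numeral_2_eq_2)
    have "bounded_operator (\<lambda>x. A (A x))"
      using bo(1) bounded_linear_compose by (auto simp: bounded_operator_def)
    then have "bounded_operator (P - A ^^ 2)"
      unfolding * [abs_def] fun_diff_def[of P] numeral_2_eq_2
      using bounded_operator_diff[OF P_bounded] by (simp add: o_def)
    then show ?thesis
      unfolding selfadjoint_operator_iff_inner *
      by (simp add: inner_diff_left inner_diff_right P_sym A_sym)
  qed
  ultimately have "MP_proper_splitting_converges A \<longleftrightarrow> onorm (P - A ^^ 2) < 1"
    by (simp add: MP_proper_splitting_converges_def convergent_proper_splitting_def pX
        spectral_radius_selfadjoint)
  then show ?thesis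
    using closed_range_bounded_below[OF cl] onorm_P_diff_square_less_1_iff unfolding M by metis
qed

end

section \<open>The positive orthogonal decomposition\<close>

theorem theorem4p9:
  fixes T T\<^sub>1 T\<^sub>2 :: "'a::complex_hilbert_space \<Rightarrow> 'a"
  assumes "selfadjoint_operator T"
    and "closed (range T)"
    and "positive_orthogonal_decomposition T T\<^sub>1 T\<^sub>2"
  shows "(MP_proper_splitting_converges T \<longleftrightarrow>
           max (onorm (range_projection T\<^sub>1 - T\<^sub>1 ^^ 2)) (onorm (range_projection T\<^sub>2 - T\<^sub>2 ^^ 2)) < 1) \<and>
         (max (onorm (range_projection T\<^sub>1 - T\<^sub>1 ^^ 2)) (onorm (range_projection T\<^sub>2 - T\<^sub>2 ^^ 2)) < 1 \<longleftrightarrow>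
           onorm T\<^sub>1 < sqrt 2 \<and> onorm T\<^sub>2 < sqrt 2) \<and>
         (onorm T\<^sub>1 < sqrt 2 \<and> onorm T\<^sub>2 < sqrt 2 \<longleftrightarrow> onorm T < sqrt 2)"
proof -
  note D = assms(3)[unfolded positive_orthogonal_decomposition_def]
  interpret T: selfadjoint_range T by unfold_locales (fact assms)
  interpret T1: selfadjoint_range T\<^sub>1
    by unfold_locales (use D positive_operator_imp_selfadjoint in blast)
  interpret T2: selfadjoint_range T\<^sub>2
    by unfold_locales (use D positive_operator_imp_selfadjoint in blast)
  have T: "T x = T\<^sub>1 x - T\<^sub>2 x" for x using D by simp
  have orth: "inner x y = 0" if "x \<in> T1.M" "y \<in> T2.M" for x y
    using D that by (simp add: inner_eq_Re_cinner)
  \<comment> \<open>With one summand \<open>0\<close>, this puts \<open>T1.M\<close> and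
    \<open>T2.M\<close> inside the closed range of \<open>T\<close>, where \<open>T\<close> is
    bounded below.\<close>
  have sum: "x + y \<in> range T" if "x \<in> T1.M" "y \<in> T2.M" for x y
  proof -
    have "x + y \<in> closure (range T)" using D that by blast
    then show ?thesis using assms(2) by simp
  qed
  obtain m where m: "0 < m" "\<And>x. x \<in> range T \<Longrightarrow> m * norm x \<le> norm (T x)"
    using T.closed_range_bounded_below[OF assms(2)] by blast
  \<comment> \<open>Such \<open>x\<close> is orthogonal to \<open>T2.M\<close>, hence killed by
    \<open>T\<^sub>2\<close>, so \<open>T x = T\<^sub>1 x\<close>.\<close>
  have below1: "m * norm x \<le> norm (T\<^sub>1 x)" if "x \<in> T1.M" for x
  proof -
    have "T\<^sub>2 x = 0" using orth that by (simp add: T2.A_eq_0_iff)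
    moreover have "x \<in> range T"
      using sum[OF that subspace_0[OF T2.subspace_M]] by simp
    ultimately show ?thesis using m(2)[of x] by (simp add: T)
  qed
  have below2: "m * norm x \<le> norm (T\<^sub>2 x)" if "x \<in> T2.M" for x
  proof -
    have "T\<^sub>1 x = 0" using orth that by (simp add: T1.A_eq_0_iff inner_commute[of x])
    moreover have "x \<in> range T"
      using sum[OF subspace_0[OF T1.subspace_M] that] by simp
    ultimately show ?thesis using m(2)[of x] by (simp add: T)
  qed
  have pyth: "(norm (T x))\<^sup>2 = (norm (T\<^sub>1 x))\<^sup>2 + (norm (T\<^sub>2 x))\<^sup>2" for x
  proof -
    have "inner (T\<^sub>1 x) (T\<^sub>2 x) = 0"
      using orth closure_subset[of "range T\<^sub>1"] closure_subset[of "range T\<^sub>2"] by blast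
    then show ?thesis
      by (simp add: T power2_norm_eq_inner inner_diff_left inner_diff_right inner_commute)
  qed
  have "onorm T = max (onorm T\<^sub>1) (onorm T\<^sub>2)"
  proof (rule antisym)
    let ?q = "max (onorm T\<^sub>1) (onorm T\<^sub>2)"
    have q0: "0 \<le> ?q" using onorm_pos_le[OF T1.A.bounded_linear_axioms] by simp
    show "onorm T \<le> ?q"
    proof (rule onorm_bound[OF q0])
      fix x
      have "inner (T1.P x) (T2.P x) = 0" by (intro orth T1.P_in T2.P_in)
      moreover have "inner (x - T1.P x) (T1.P x) = 0" "inner (x - T2.P x) (T2.P x) = 0"
        by (intro T1.P_orth T1.P_in T2.P_orth T2.P_in)+
      \<comment> \<open>Expanding this square yields Bessel's inequality for the two orthogonal
        projections of \<open>x\<close>.\<close>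
      moreover have "0 \<le> (norm (x - (T1.P x + T2.P x)))\<^sup>2" by simp
      ultimately have P: "(norm (T1.P x))\<^sup>2 + (norm (T2.P x))\<^sup>2 \<le> (norm x)\<^sup>2"
        by (simp add: power2_norm_eq_inner inner_diff_left inner_diff_right inner_add_left
            inner_add_right inner_commute)
      have "norm (T\<^sub>1 x) \<le> ?q * norm (T1.P x)"
        using onorm[OF T1.A.bounded_linear_axioms, of "T1.P x"]
        by (simp add: T1.A_P) (meson max.cobounded1 mult_right_mono norm_ge_zero order_trans)
      moreover have "norm (T\<^sub>2 x) \<le> ?q * norm (T2.P x)"
        using onorm[OF T2.A.bounded_linear_axioms, of "T2.P x"]
        by (simp add: T2.A_P) (meson max.cobounded2 mult_right_mono norm_ge_zero order_trans)
      ultimately have "(norm (T x))\<^sup>2 \<le> (?q * norm (T1.P x))\<^sup>2 + (?q * norm (T2.P x))\<^sup>2"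
        unfolding pyth by (intro add_mono power_mono) auto
      also have "\<dots> = ?q\<^sup>2 * ((norm (T1.P x))\<^sup>2 + (norm (T2.P x))\<^sup>2)"
        by (simp only: power_mult_distrib distrib_left)
      also have "\<dots> \<le> ?q\<^sup>2 * (norm x)\<^sup>2"
        by (intro mult_left_mono P) simp
      finally have "(norm (T x))\<^sup>2 \<le> (?q * norm x)\<^sup>2" by (simp only: power_mult_distrib)
      then show "norm (T x) \<le> ?q * norm x"
        using q0 by (rule power2_le_imp_le[OF _ mult_nonneg_nonneg]) simp
    qed
    have "onorm S \<le> onorm T" if "\<And>x. norm (S x) \<le> norm (T x)" for S :: "'a \<Rightarrow> 'a"
      using that onorm[OF T.A.bounded_linear_axioms] onorm_pos_le[OF T.A.bounded_linear_axioms]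
      by (meson onorm_bound order_trans)
    moreover have "norm (T\<^sub>1 x) \<le> norm (T x)" "norm (T\<^sub>2 x) \<le> norm (T x)" for x
      using pyth[of x] by (auto intro: power2_le_imp_le)
    ultimately show "?q \<le> onorm T" by simp
  qed
  \<comment> \<open>The norm identity links (3) and (4), the lemma on \<open>P - A ^^ 2\<close>
    links (2) and (3) with the common bound \<open>m\<close>, and the splitting lemma links (1) and
    (4).\<close>
  then show ?thesis
    using T.MP_proper_splitting_converges_iff[OF assms(2)]
      T1.onorm_P_diff_square_less_1_iff[OF m(1) below1] T2.onorm_P_diff_square_less_1_iff[OF m(1) below2]
    by simp
qed

end
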